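(* For integers $j\ge 0$ and $k\ge 0$ let $$a_{j,k}:=\frac{(-\pi^2/4)^k}{(2j+2k)!}\binom{j+k}{j},\qquad t_j:=\sum_{k=0}^\infty a_{j,k}.$$ Then the following hold. (i) For every real $x$, $$\cos\pi x=\sum_{j=1}^\infty t_j\,\pi^{2j}\,(1/4-x^2)^j .$$ (ii) One has $t_0=0$, $t_1=1/\pi$, and for all integers $j\ge 2$, $$t_j=\frac{2(2j-3)}{\pi^2 j}\,t_{j-1}-\frac{1}{\pi^2 j(j-1)}\,t_{j-2}.$$ (iii) For all integers $j\ge 1$, $$0<t_j<\frac{1}{(2j)!}.$$ (iv) $t_j\sim \dfrac{1}{(2j)!}$ as $j\to\infty$, that is, $(2j)!\,t_j\to 1$ as $j\to\infty$. *)

theory Defs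
  imports "HOL-Analysis.Analysis" "HOL-Library.Landau_Symbols"
begin

definition a :: "nat \<Rightarrow> nat \<Rightarrow> real" where
  "a j k = (- (pi\<^sup>2 / 4)) ^ k / fact (2 * j + 2 * k) * real ((j + k) choose j)"

definition t :: "nat \<Rightarrow> real" where
  "t j = (\<Sum>k. a j k)"

text \<open>The series defining \<open>t j\<close> converges absolutely, so \<open>t j\<close> is its genuine sum
  and not a default value of \<open>suminf\<close>.\<close>

lemma summable_norm_a: "summable (\<lambda>k. norm (a j k))"
proof (rule summable_comparison_test)
  have "summable (\<lambda>k. 2 ^ j * (inverse (fact k) * (pi\<^sup>2 / 2) ^ k :: real))"
    by (intro summable_mult summable_exp)
  then show "summable (\<lambda>k. 2 ^ j * ((pi\<^sup>2 / 2) ^ k / fact k :: real))"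
    by (simp add: field_simps)
  have "norm (norm (a j k)) \<le> 2 ^ j * ((pi\<^sup>2 / 2) ^ k / fact k)" for k
  proof -
    have "(j + k) choose j \<le> 2 ^ (j + k)"
      by (rule binomial_le_pow2)
    then have b: "real ((j + k) choose j) \<le> 2 ^ (j + k)"
      by (metis of_nat_le_iff of_nat_numeral of_nat_power)
    have f: "(fact k :: real) \<le> fact (2 * j + 2 * k)"
      by (rule fact_mono) simp
    have "norm (norm (a j k)) =
        (pi\<^sup>2 / 4) ^ k / fact (2 * j + 2 * k) * real ((j + k) choose j)"
      by (simp add: a_def abs_mult power_abs)
    also have "\<dots> \<le> (pi\<^sup>2 / 4) ^ k / fact k * 2 ^ (j + k)"
      by (intro mult_mono divide_left_mono b f) auto
    also have "\<dots> = 2 ^ j * (((pi\<^sup>2 / 4) ^ k * 2 ^ k) / fact k)"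
      by (simp add: power_add field_simps)
    also have "\<dots> = 2 ^ j * ((pi\<^sup>2 / 2) ^ k / fact k)"
      by (simp flip: power_mult_distrib)
    finally show ?thesis .
  qed
  then show "\<exists>N. \<forall>k\<ge>N. norm (norm (a j k)) \<le> 2 ^ j * ((pi\<^sup>2 / 2) ^ k / fact k)"
    by blast
qed

lemma a_sums_t: "a j sums t j"
  unfolding t_def
  using summable_norm_cancel[OF summable_norm_a[of j]] by (simp add: summable_sums)

end

theory Submission
  imports Defs "HOL-Real_Asymp.Real_Asymp"
begin

text \<open>
  Put \<open>u = \<pi>\<^sup>2 (1/4 - x\<^sup>2)\<close> in \<open>cos (\<pi> x) = (\<Sum>n. (u - \<pi>\<^sup>2/4)\<^sup>n / (2 n)!)\<close>, expand each power binomially and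
  collect the powers of \<open>u\<close>; absolute convergence allows this and the coefficient of
  \<open>u\<^sup>j\<close> is \<open>t j\<close>. The recurrence holds between the coefficients of each power of \<open>\<pi>\<^sup>2\<close>.
  For \<open>j \<ge> 1\<close> the series \<open>t j\<close> is alternating with terms of decreasing modulus, since
  \<open>\<bar>a j (k + 1)\<bar> / \<bar>a j k\<bar> = \<pi>\<^sup>2 / (8 (k + 1) (2 j + 2 k + 1)) < 1\<close>, so Leibniz's bounds from its first
  terms give the estimates and the asymptotics.
\<close>

section \<open>Expansion of the cosine in powers of \<open>u\<close>\<close>

text \<open>All terms with \<open>j + k = n\<close> share the denominator
  \<open>fact (2 * n)\<close>, so the binomial theorem adds them up.\<close>

lemma sum_a_diagonal:
  "(\<Sum>j\<le>n. u ^ j * a j (n - j)) = (u - pi\<^sup>2 / 4) ^ n / fact (2 * n)"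
proof -
  have "u ^ j * a j (n - j)
      = real (n choose j) * u ^ j * (- (pi\<^sup>2 / 4)) ^ (n - j) / fact (2 * n)" if "j \<le> n" for j
  proof -
    have "2 * j + 2 * (n - j) = 2 * n" using that by simp
    then show ?thesis using that by (simp add: a_def)
  qed
  then have "(\<Sum>j\<le>n. u ^ j * a j (n - j))
      = (\<Sum>j\<le>n. real (n choose j) * u ^ j * (- (pi\<^sup>2 / 4)) ^ (n - j)) / fact (2 * n)"
    by (simp add: sum_divide_distrib)
  also have "\<dots> = (u + - (pi\<^sup>2 / 4)) ^ n / fact (2 * n)"
    by (simp only: binomial_ring)
  finally show ?thesis by simp
qed

text \<open>With every sign made positive the binomial theorem still gives a closed form; its
  summability over \<open>n\<close> makes the family of all \<open>u ^ j * a j k\<close> absolutely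
  summable.\<close>

lemma sum_norm_a_diagonal:
  "(\<Sum>j\<le>n. norm (u ^ j * a j (n - j))) = (\<bar>u\<bar> + pi\<^sup>2 / 4) ^ n / fact (2 * n)"
proof -
  have "norm (u ^ j * a j (n - j))
      = real (n choose j) * \<bar>u\<bar> ^ j * (pi\<^sup>2 / 4) ^ (n - j) / fact (2 * n)" if "j \<le> n" for j
  proof -
    have "2 * j + 2 * (n - j) = 2 * n" using that by simp
    then show ?thesis using that by (simp add: a_def abs_mult power_abs)
  qed
  then have "(\<Sum>j\<le>n. norm (u ^ j * a j (n - j)))
      = (\<Sum>j\<le>n. real (n choose j) * \<bar>u\<bar> ^ j * (pi\<^sup>2 / 4) ^ (n - j)) / fact (2 * n)"
    by (simp add: sum_divide_distrib)
  also have "\<dots> = (\<bar>u\<bar> + pi\<^sup>2 / 4) ^ n / fact (2 * n)"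
    by (simp only: binomial_ring)
  finally show ?thesis .
qed

lemma summable_power_div_fact_double:
  fixes z :: real
  assumes "0 \<le> z"
  shows "summable (\<lambda>n. z ^ n / fact (2 * n))"
proof (rule summable_comparison_test')
  show "summable (\<lambda>n. z ^ n / fact n)"
    using summable_exp[of z] by (simp add: field_simps)
  show "norm (z ^ n / fact (2 * n)) \<le> z ^ n / fact n" if "n \<ge> 0" for n
    using assms by (auto intro!: divide_left_mono fact_mono)
qed

lemma cos_sums_shifted:
  fixes x :: real
  shows "(\<lambda>n. (pi\<^sup>2 * (1 / 4 - x\<^sup>2) - pi\<^sup>2 / 4) ^ n / fact (2 * n)) sums cos (pi * x)"
proof -
  have "(- 1) ^ n / fact (2 * n) * (pi * x) ^ (2 * n)
      = (pi\<^sup>2 * (1 / 4 - x\<^sup>2) - pi\<^sup>2 / 4) ^ n / fact (2 * n)" for n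
  proof -
    have "pi\<^sup>2 * (1 / 4 - x\<^sup>2) - pi\<^sup>2 / 4 = (- 1) * (pi * x)\<^sup>2"
      by (simp add: field_simps power2_eq_square)
    then show ?thesis
      by (simp only: power_mult_distrib power_mult) simp
  qed
  then show ?thesis
    using cos_paired[of "pi * x"] by simp
qed

text \<open>Summing the absolutely summable double family along the diagonals
  \<open>j + k = n\<close> gives the cosine, summing it over \<open>k\<close> first gives the series
  in \<open>t j\<close>; both orders have the same sum.\<close>

lemma t_power_sums_cos:
  fixes x :: real
  shows "(\<lambda>j. (pi\<^sup>2 * (1 / 4 - x\<^sup>2)) ^ j * t j) sums cos (pi * x)"
proof -
  define u where "u = pi\<^sup>2 * (1 / 4 - x\<^sup>2)"
  \<comment> \<open>\<open>g\<close> on \<open>S\<close> lists the products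
    \<open>u ^ j * a j k\<close> by diagonals, with \<open>n\<close> standing for
    \<open>j + k\<close>.\<close>
  define g where "g = (\<lambda>(n, j). u ^ j * a j (n - j))"
  define S where "S = Sigma (UNIV :: nat set) (\<lambda>n. {..n})"
  have "(\<lambda>p. norm (g p)) summable_on S"
    unfolding S_def
  proof (rule summable_on_SigmaI)
    show "((\<lambda>j. norm (g (n, j))) has_sum (\<bar>u\<bar> + pi\<^sup>2 / 4) ^ n / fact (2 * n)) {..n}" for n
      unfolding g_def using sum_norm_a_diagonal[where u = u and n = n]
      by (intro has_sum_finiteI) auto
    show "(\<lambda>n. (\<bar>u\<bar> + pi\<^sup>2 / 4) ^ n / fact (2 * n)) summable_on UNIV"
      using summable_power_div_fact_double[of "\<bar>u\<bar> + pi\<^sup>2 / 4"]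
      by (intro norm_summable_imp_summable_on) simp
  qed auto
  then have "g summable_on S"
    by (rule abs_summable_summable)
  then obtain s where s: "(g has_sum s) S"
    by (auto simp: summable_on_def)
  have "((\<lambda>n. (u - pi\<^sup>2 / 4) ^ n / fact (2 * n)) has_sum s) UNIV"
  proof (rule has_sum_SigmaD)
    show "(g has_sum s) (Sigma UNIV (\<lambda>n. {..n}))"
      using s by (simp add: S_def)
    show "((\<lambda>j. g (n, j)) has_sum (u - pi\<^sup>2 / 4) ^ n / fact (2 * n)) {..n}" for n
      unfolding g_def using sum_a_diagonal[where u = u and n = n]
      by (intro has_sum_finiteI) auto
  qed
  then have "s = cos (pi * x)"
    using cos_sums_shifted[of x] has_sum_imp_sums sums_unique2 unfolding u_def by blast
  \<comment> \<open>The truncated subtraction \<open>n - j\<close> inverts the reindexing because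
    \<open>j\<close> is at most \<open>n\<close> on \<open>S\<close>.\<close>
  have "((\<lambda>(j, k). u ^ j * a j k) has_sum s) (UNIV \<times> UNIV) \<longleftrightarrow> (g has_sum s) S"
    by (rule has_sum_reindex_bij_witness[where i = "\<lambda>(n, j). (j, n - j)" and j = "\<lambda>(j, k). (j + k, j)"])
      (auto simp: S_def g_def)
  then have "((\<lambda>(j, k). u ^ j * a j k) has_sum s) (UNIV \<times> UNIV)"
    using s by simp
  then have "((\<lambda>j. u ^ j * t j) has_sum s) UNIV"
  proof (rule has_sum_SigmaD)
    have "((\<lambda>k. a j k) has_sum t j) UNIV" for j
      using summable_norm_a a_sums_t by (intro norm_summable_imp_has_sum)
    then show "((\<lambda>k. case (j, k) of (j, k) \<Rightarrow> u ^ j * a j k) has_sum u ^ j * t j) UNIV" for j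
      by (auto intro: has_sum_cmult_right)
  qed
  then show ?thesis
    using has_sum_imp_sums \<open>s = cos (pi * x)\<close> unfolding u_def by blast
qed

section \<open>Initial values from the cosine and sine series at \<open>pi / 2\<close>\<close>

lemma t_0: "t 0 = 0"
proof -
  have "a 0 k = (- 1) ^ k / fact (2 * k) * (pi / 2) ^ (2 * k)" for k
  proof -
    have "- (pi\<^sup>2 / 4) = (- 1) * (pi / 2)\<^sup>2"
      by (simp add: power2_eq_square)
    then show ?thesis
      unfolding a_def by (simp only: power_mult_distrib power_mult) simp
  qed
  then have "a 0 sums cos (pi / 2)"
    using cos_paired[of "pi / 2"] by presburger
  from sums_unique2[OF a_sums_t this] show ?thesis
    by simp
qed

text \<open>The binomial factor \<open>k + 1\<close> cancels against the factor
  \<open>2 * k + 2\<close> of the factorial, which leaves the sine series at \<open>pi / 2\<close>,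
  up to the factor \<open>1 / pi\<close>.\<close>

lemma t_1: "t 1 = 1 / pi"
proof -
  have "a 1 k = (1 / pi) * ((- 1) ^ k / fact (2 * k + 1) * (pi / 2) ^ (2 * k + 1))" for k
  proof -
    have "- (pi\<^sup>2 / 4) = (- 1) * (pi / 2)\<^sup>2"
      by (simp add: power2_eq_square)
    then have p: "(- (pi\<^sup>2 / 4)) ^ k = (- 1) ^ k * (pi / 2) ^ (2 * k)"
      by (simp only: power_mult_distrib power_mult)
    have "fact (2 * 1 + 2 * k) = (2 * (real k + 1)) * (fact (2 * k + 1) :: real)"
      by (simp add: field_simps)
    then have "a 1 k = (- 1) ^ k * (pi / 2) ^ (2 * k) / ((2 * (real k + 1)) * fact (2 * k + 1)) * (real k + 1)"
      unfolding a_def p by (simp add: add.commute del: fact_Suc)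
    also have "\<dots> = (1 / pi) * ((- 1) ^ k / fact (2 * k + 1) * (pi / 2) ^ (2 * k + 1))"
    proof -
      have "c * P / (2 * q * F) * q = 1 / pi * (c / F * (pi / 2 * P))"
        if "q > 0" "F > 0" for c P q F :: real
        using that by (simp add: field_simps)
      from this[of "real k + 1" "fact (2 * k + 1)"] show ?thesis by simp
    qed
    finally show ?thesis .
  qed
  moreover have "(\<lambda>k. (1 / pi) * ((- 1) ^ k / fact (2 * k + 1) * (pi / 2) ^ (2 * k + 1))) sums (1 / pi * sin (pi / 2))"
    by (intro sums_mult sin_paired)
  ultimately have "a 1 sums (1 / pi * sin (pi / 2))"
    by presburger
  from sums_unique2[OF a_sums_t this] show ?thesis
    by simp
qed

section \<open>Three-term recurrence\<close>

text \<open>Read as a power series in \<open>pi^2\<close>, the left side of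
  \<open>t_recurrence\<close> has no constant term, so the constant terms on its right must
  cancel.\<close>

lemma a_recurrence_0: "2 * (2 * real i + 1) * (real i + 1) * a (Suc i) 0 = a i 0"
proof -
  have "fact (2 * Suc i) = (2 * real i + 2) * (2 * real i + 1) * (fact (2 * i) :: real)"
    by (simp add: field_simps)
  then show ?thesis
    unfolding a_def by (simp add: divide_simps del: fact_Suc) (simp add: algebra_simps)
qed

text \<open>This compares the terms with power \<open>k + 1\<close> of \<open>pi^2\<close>; the
  explicit \<open>pi^2\<close> on the left accounts for the index \<open>k\<close> there against
  \<open>Suc k\<close> on the right.\<close>

lemma a_recurrence_Suc:
  "pi\<^sup>2 * (real i + 2) * (real i + 1) * a (i + 2) k
    = 2 * (2 * real i + 1) * (real i + 1) * a (Suc i) (Suc k) - a i (Suc k)"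
proof -
  \<comment> \<open>The factorial in \<open>a i (Suc k)\<close> is that of \<open>2 * m\<close>; in
    the other two terms it is that of \<open>2 * m + 2\<close>.\<close>
  define m where "m = i + k + 1"
  define F :: real where "F = fact (2 * m)"
  define B where "B = real (Suc m choose Suc i)"
  define q where "q = (- (pi\<^sup>2 / 4)) ^ k"
  have F: "F > 0" by (simp add: F_def)
  have fact: "fact (2 * m + 2) = (2 * real m + 2) * (2 * real m + 1) * F"
    by (simp add: F_def field_simps)
  have b2: "(real i + 2) * real (Suc m choose (i + 2)) = (real k + 1) * B"
  proof -
    have "(Suc m choose Suc (Suc i)) * Suc (Suc i) = (Suc m choose Suc i) * (Suc m - Suc i)"
      by (metis binomial_absorb_comp binomial_absorption mult.commute diff_Suc_Suc)
    then have "real ((Suc m choose Suc (Suc i)) * Suc (Suc i)) = real ((Suc m choose Suc i) * Suc k)"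
      by (simp only: m_def) simp
    then show ?thesis by (simp add: B_def algebra_simps)
  qed
  have b0: "(real m + 1) * real (m choose i) = (real i + 1) * B"
  proof -
    have "Suc m * (m choose i) = Suc i * (Suc m choose Suc i)"
      using Suc_times_binomial by metis
    then have "real (Suc m * (m choose i)) = real (Suc i * (Suc m choose Suc i))" by (simp only:)
    then show ?thesis by (simp add: B_def algebra_simps)
  qed
  have a2: "a (i + 2) k = q / ((2 * real m + 2) * (2 * real m + 1) * F) * real (Suc m choose (i + 2))"
    unfolding a_def q_def fact[symmetric] by (simp add: m_def del: fact_Suc)
  have a1: "a (Suc i) (Suc k) = - (pi\<^sup>2 / 4) * q / ((2 * real m + 2) * (2 * real m + 1) * F) * B"
    unfolding a_def q_def fact[symmetric] B_def by (simp add: m_def del: fact_Suc)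
  have a0: "a i (Suc k) = - (pi\<^sup>2 / 4) * q / F * real (m choose i)"
    unfolding a_def q_def F_def by (simp add: m_def del: fact_Suc)
  \<comment> \<open>All three terms become multiples of \<open>r * B\<close>.\<close>
  define r where "r = q / ((2 * real m + 2) * (2 * real m + 1) * F)"
  have a2: "(real i + 2) * a (i + 2) k = r * ((real k + 1) * B)"
    unfolding a2 r_def b2[symmetric] by (simp only: mult_ac)
  have a1: "a (Suc i) (Suc k) = - (pi\<^sup>2 / 4) * r * B"
    unfolding a1 r_def by simp
  have "q / F = r * ((2 * real m + 2) * (2 * real m + 1))"
  proof -
    have "q / F = q / (x * y * F) * (x * y)" if "x > 0" "y > 0" for x y :: real
      using that by simp
    from this[of "2 * real m + 2" "2 * real m + 1"] show ?thesis
      unfolding r_def by simp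
  qed
  then have "a i (Suc k)
      = - (pi\<^sup>2 / 4) * (r * ((2 * real m + 2) * (2 * real m + 1))) * real (m choose i)"
    unfolding a0 by (metis times_divide_eq_right)
  also have "\<dots>
      = - (pi\<^sup>2 / 4) * r * (2 * (2 * real m + 1)) * ((real m + 1) * real (m choose i))"
    by (simp add: algebra_simps)
  finally have a0: "a i (Suc k) = - (pi\<^sup>2 / 4) * r * (2 * (2 * real m + 1)) * ((real i + 1) * B)"
    unfolding b0 .
  have "pi\<^sup>2 * (real i + 2) * (real i + 1) * a (i + 2) k
      = pi\<^sup>2 * (real i + 1) * ((real i + 2) * a (i + 2) k)"
    by (simp only: mult_ac)
  \<comment> \<open>The identity comes down to
    \<open>(2 * m + 1) - (2 * i + 1) = 2 * (k + 1)\<close>.\<close>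
  also have "\<dots> = 2 * (2 * real i + 1) * (real i + 1) * a (Suc i) (Suc k) - a i (Suc k)"
    unfolding a2 a1 a0 by (simp add: m_def algebra_simps)
  finally show ?thesis .
qed

text \<open>The coefficient identities are summed over \<open>k\<close>. Shifted indices and cleared
  denominators avoid truncated subtraction and division.\<close>

lemma t_recurrence:
  "pi\<^sup>2 * (real i + 2) * (real i + 1) * t (i + 2)
    = 2 * (2 * real i + 1) * (real i + 1) * t (Suc i) - t i"
proof -
  have tail: "(\<lambda>k. a j (Suc k)) sums (t j - a j 0)" for j
    using a_sums_t[of j] by (simp add: sums_Suc_iff)
  have "(\<lambda>k. pi\<^sup>2 * (real i + 2) * (real i + 1) * a (i + 2) k)
      sums (2 * (2 * real i + 1) * (real i + 1) * (t (Suc i) - a (Suc i) 0) - (t i - a i 0))"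
    unfolding a_recurrence_Suc by (intro sums_diff sums_mult tail)
  moreover have "(\<lambda>k. pi\<^sup>2 * (real i + 2) * (real i + 1) * a (i + 2) k)
      sums (pi\<^sup>2 * (real i + 2) * (real i + 1) * t (i + 2))"
    by (intro sums_mult a_sums_t)
  ultimately have "pi\<^sup>2 * (real i + 2) * (real i + 1) * t (i + 2)
      = 2 * (2 * real i + 1) * (real i + 1) * (t (Suc i) - a (Suc i) 0) - (t i - a i 0)"
    by (rule sums_unique2[symmetric])
  also have "\<dots> = 2 * (2 * real i + 1) * (real i + 1) * t (Suc i)
      - 2 * (2 * real i + 1) * (real i + 1) * a (Suc i) 0 - t i + a i 0"
    by (simp only: right_diff_distrib)
  finally show ?thesis
    unfolding a_recurrence_0 by simp
qed

lemma t_recurrence_divided: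
  assumes "j \<ge> 2"
  shows "t j = 2 * (2 * real j - 3) / (pi\<^sup>2 * real j) * t (j - 1)
    - 1 / (pi\<^sup>2 * real j * (real j - 1)) * t (j - 2)"
proof -
  obtain i where j: "j = i + 2"
    using assms by (metis add.commute le_Suc_ex)
  have solve: "z = 2 * c / (P * x) * v - 1 / (P * x * y) * w"
    if "P * x * y * z = 2 * c * y * v - w" "P > 0" "x > 0" "y > 0" for P x y z c v w :: real
    using that by (simp add: field_simps)
  have "t (i + 2) = 2 * (2 * real i + 1) / (pi\<^sup>2 * (real i + 2)) * t (Suc i)
      - 1 / (pi\<^sup>2 * (real i + 2) * (real i + 1)) * t i"
    by (rule solve[OF t_recurrence]) auto
  moreover have "2 * real j - 3 = 2 * real i + 1" "real j = real i + 2" "real j - 1 = real i + 1"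
    "j - 1 = Suc i" "j - 2 = i"
    by (simp_all add: j)
  ultimately show ?thesis
    by (simp only: j)
qed

section \<open>Alternating series estimates\<close>

lemma abs_a_Suc:
  "\<bar>a j (Suc k)\<bar> = \<bar>a j k\<bar> * (pi\<^sup>2 / (8 * (real k + 1) * (2 * real j + 2 * real k + 1)))"
proof -
  define n where "n = j + k"
  define F :: real where "F = fact (2 * n)"
  have "F > 0" by (simp add: F_def)
  have fact: "fact (2 * n + 2) = 2 * (real n + 1) * (2 * real n + 1) * F"
    by (simp add: F_def field_simps)
  \<comment> \<open>The absorption identity raises both indices, so it is used with lower index
    \<open>k\<close>; symmetry then returns to the fixed lower index \<open>j\<close>.\<close>
  have "Suc n * (n choose k) = Suc k * (Suc n choose Suc k)"
    using Suc_times_binomial by metis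
  then have "real (Suc n * (n choose k)) = real (Suc k * (Suc n choose Suc k))"
    by (simp only:)
  moreover have "n choose k = n choose j" "Suc n choose Suc k = Suc n choose j"
    by (simp_all add: n_def binomial_symmetric[of j] del: binomial_Suc_Suc)
  ultimately have "(real n + 1) * real (n choose j) = (real k + 1) * real (Suc n choose j)"
    by (simp only: of_nat_mult of_nat_Suc add.commute)
  then have b: "real (Suc n choose j) = (real n + 1) * real (n choose j) / (real k + 1)"
    by (simp add: nonzero_eq_divide_eq mult.commute)
  have step: "P / 4 * q / (2 * x * y * F) * (x * c / z) = q / F * c * (P / (8 * z * y))"
    if "x > 0" "y > 0" "z > 0" for P q x y z c :: real
    using that \<open>F > 0\<close> by (simp add: field_simps)
  have "\<bar>a j (Suc k)\<bar> = pi\<^sup>2 / 4 * (pi\<^sup>2 / 4) ^ k / fact (2 * n + 2) * real (Suc n choose j)"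
    unfolding a_def by (simp add: abs_mult power_abs n_def del: fact_Suc)
  also have "\<dots> = (pi\<^sup>2 / 4) ^ k / F * real (n choose j)
      * (pi\<^sup>2 / (8 * (real k + 1) * (2 * real n + 1)))"
    unfolding b fact by (rule step) auto
  also have "(pi\<^sup>2 / 4) ^ k / F * real (n choose j) = \<bar>a j k\<bar>"
    unfolding a_def by (simp add: abs_mult power_abs n_def F_def)
  finally show ?thesis
    by (simp add: n_def)
qed

lemma a_eq_alternating: "a j k = (- 1) ^ k * \<bar>a j k\<bar>"
proof -
  have "(- (pi\<^sup>2 / 4)) ^ k = (- 1) ^ k * (pi\<^sup>2 / 4) ^ k"
    by (metis mult_minus1 power_mult_distrib)
  then show ?thesis
    by (simp add: a_def abs_mult)
qed

lemma a_pos: "0 < \<bar>a j k\<bar>"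
  by (simp add: a_def)

lemma abs_a_0: "\<bar>a j 0\<bar> = 1 / fact (2 * j)"
  by (simp add: a_def)

lemma pi_power2_less_16: "pi\<^sup>2 < 16"
proof -
  have "pi\<^sup>2 < 4\<^sup>2"
    by (rule power_strict_mono) (use pi_less_4 in auto)
  then show ?thesis by simp
qed

lemma abs_a_Suc_less:
  assumes "j \<ge> 1"
  shows "\<bar>a j (Suc k)\<bar> < \<bar>a j k\<bar>"
proof -
  \<comment> \<open>The denominator is smallest at \<open>j = 1\<close>, \<open>k = 0\<close>, where
    it is 24 and exceeds \<open>pi^2\<close>.\<close>
  have "8 * 1 * 3 \<le> 8 * (real k + 1) * (2 * real j + 2 * real k + 1)"
    using assms by (intro mult_mono) auto
  then have "pi\<^sup>2 / (8 * (real k + 1) * (2 * real j + 2 * real k + 1)) < 1"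
    using pi_power2_less_16 by (subst divide_less_eq_1_pos) linarith+
  then show ?thesis
    unfolding abs_a_Suc using a_pos[of j k] by (simp only: mult_less_cancel_left2) simp
qed

lemma t_Leibniz_bounds:
  assumes "j \<ge> 1"
  shows "(\<Sum>k<2 * n. a j k) \<le> t j" "t j \<le> (\<Sum>k<2 * n + 1. a j k)"
proof -
  have lim: "(\<lambda>k. \<bar>a j k\<bar>) \<longlonglongrightarrow> 0"
    using summable_LIMSEQ_zero[OF summable_norm_a[of j]] by simp
  have nonneg: "0 \<le> \<bar>a j k\<bar>" for k by simp
  have decr: "\<bar>a j (Suc k)\<bar> \<le> \<bar>a j k\<bar>" for k
    using abs_a_Suc_less[OF assms] less_imp_le by blast
  note L = summable_Leibniz'[of "\<lambda>k. \<bar>a j k\<bar>", OF lim nonneg decr, folded a_eq_alternating]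
  show "(\<Sum>k<2 * n. a j k) \<le> t j" "t j \<le> (\<Sum>k<2 * n + 1. a j k)"
    unfolding t_def using L(2)[of n] L(4)[of n] by auto
qed

text \<open>The first partial sum alone would give only a weak inequality. With three terms, the
  strict decrease from \<open>\<bar>a j 1\<bar>\<close> to \<open>\<bar>a j 2\<bar>\<close> makes it
  strict.\<close>

lemma t_less:
  assumes "j \<ge> 1"
  shows "t j < 1 / fact (2 * j)"
proof -
  have "t j \<le> a j 0 + a j 1 + a j 2"
    using t_Leibniz_bounds(2)[OF assms, of 1] by (simp add: numeral_eq_Suc)
  also have "\<dots> = 1 / fact (2 * j) - \<bar>a j 1\<bar> + \<bar>a j 2\<bar>"
    using a_eq_alternating[of j 0] a_eq_alternating[of j 1] a_eq_alternating[of j 2]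
    by (simp add: abs_a_0)
  also have "\<dots> < 1 / fact (2 * j)"
    using abs_a_Suc_less[OF assms, of 1] by (simp add: numeral_2_eq_2)
  finally show ?thesis .
qed

text \<open>This is the Leibniz bound by the first two terms; the subtracted quotient is the ratio
  of \<open>abs_a_Suc\<close> at \<open>k = 0\<close>.\<close>

lemma t_lower_bound:
  assumes "j \<ge> 1"
  shows "(1 - pi\<^sup>2 / (8 * (2 * real j + 1))) / fact (2 * j) \<le> t j"
proof -
  have "a j 0 + a j 1 \<le> t j"
    using t_Leibniz_bounds(1)[OF assms, of 1] by (simp add: numeral_eq_Suc)
  moreover have "a j 0 + a j 1 = \<bar>a j 0\<bar> - \<bar>a j (Suc 0)\<bar>"
    using a_eq_alternating[of j 0] a_eq_alternating[of j 1] by simp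
  ultimately show ?thesis
    unfolding abs_a_Suc abs_a_0 by (simp add: diff_divide_distrib mult.commute)
qed

lemma t_pos:
  assumes "j \<ge> 1"
  shows "0 < t j"
proof -
  have "16 \<le> 8 * (2 * real j + 1)"
    using assms by simp
  then have "pi\<^sup>2 < 8 * (2 * real j + 1)"
    using pi_power2_less_16 by linarith
  then have "0 < (1 - pi\<^sup>2 / (8 * (2 * real j + 1))) / fact (2 * j)"
    by simp
  then show ?thesis
    using t_lower_bound[OF assms] by linarith
qed

text \<open>Multiplied by \<open>fact (2 * j)\<close>, the two-term lower bound tends to 1 and the
  upper bound is 1. Both bounds need \<open>j \<ge> 1\<close>, hence hold eventually.\<close>

lemma fact_t_tendsto_1: "(\<lambda>j. fact (2 * j) * t j) \<longlonglongrightarrow> 1"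
proof (rule tendsto_sandwich)
  show "(\<lambda>j. 1 - pi\<^sup>2 / (8 * (2 * real j + 1))) \<longlonglongrightarrow> 1"
    by real_asymp
  show "\<forall>\<^sub>F j in sequentially. 1 - pi\<^sup>2 / (8 * (2 * real j + 1)) \<le> fact (2 * j) * t j"
    using eventually_ge_at_top[of 1]
  proof eventually_elim
    case (elim j)
    show ?case
      using t_lower_bound[OF elim] by (simp add: pos_divide_le_eq mult.commute)
  qed
  show "\<forall>\<^sub>F j in sequentially. fact (2 * j) * t j \<le> 1"
    using eventually_ge_at_top[of 1]
  proof eventually_elim
    case (elim j)
    show ?case
      using t_less[OF elim] by (simp add: pos_less_divide_eq mult.commute)
  qed
qed auto

theorem theorem1p1:
  shows "(\<forall>x::real. (\<lambda>n. t (Suc n) * pi ^ (2 * Suc n) * (1 / 4 - x\<^sup>2) ^ Suc n) sums cos (pi * x))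
    \<and> (t 0 = 0 \<and> t 1 = 1 / pi \<and>
       (\<forall>j\<ge>2. t j = 2 * (2 * real j - 3) / (pi\<^sup>2 * real j) * t (j - 1)
                    - 1 / (pi\<^sup>2 * real j * (real j - 1)) * t (j - 2)))
    \<and> (\<forall>j\<ge>1. 0 < t j \<and> t j < 1 / fact (2 * j))
    \<and> t \<sim>[at_top] (\<lambda>j. 1 / fact (2 * j))
    \<and> (\<lambda>j. fact (2 * j) * t j) \<longlonglongrightarrow> 1"
proof (intro conjI allI impI)
  fix x :: real
  let ?f = "\<lambda>j. t j * pi ^ (2 * j) * (1 / 4 - x\<^sup>2) ^ j"
  have "(pi\<^sup>2 * (1 / 4 - x\<^sup>2)) ^ j * t j = ?f j" for j
    by (simp add: power_mult_distrib flip: power_mult)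
  then have "?f sums cos (pi * x)"
    using t_power_sums_cos[of x] by presburger
  \<comment> \<open>The series may start at index 1 because the term at 0 vanishes by
    \<open>t_0\<close>.\<close>
  then show "(\<lambda>n. ?f (Suc n)) sums cos (pi * x)"
    by (subst sums_Suc_iff) (simp add: t_0)
next
  show "t \<sim>[at_top] (\<lambda>j. 1 / fact (2 * j))"
    using fact_t_tendsto_1 by (intro asymp_equivI') (simp add: mult.commute)
qed (use t_0 t_1 t_recurrence_divided t_pos t_less fact_t_tendsto_1 in auto)

end
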